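(* For $m\in\{2,3,4\}$ and $t\in[0,1]$ let \[ A_{t,m}=\begin{pmatrix}0&1&t&t^m\\0&0&1&t\\0&0&0&1\\0&0&0&0\end{pmatrix}, \] and set $t_2^*=0.363$, $t_3^*=0.368$, $t_4^*=0.367$. Then for each $m\in\{2,3,4\}$ and each $t\in[0,t_m^*]$, the matrix $A_{t,m}$ satisfies Crouzeix's conjecture, i.e. for every polynomial $p\in\mathbb{C}[z]$, \[ \|p(A_{t,m})\|\le 2\max_{z\in W(A_{t,m})}|p(z)|. \]
   Context: For an $n\times n$ complex matrix $A$, $\|A\|$ is the operator norm induced by the Euclidean norm on $\mathbb{C}^n$, and $W(A)=\{\langle Ax,x\rangle : x\in\mathbb{C}^n,\ \|x\|=1\}$ is the numerical range (a compact convex set). *)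

theory Defs
  imports "HOL-Analysis.Analysis" "HOL-Computational_Algebra.Polynomial"
begin

(* The library's inner product on complex^'n is real-valued: it is the real part of this one. *)
definition cdot :: "complex^'n \<Rightarrow> complex^'n \<Rightarrow> complex"
  where "cdot x y = (\<Sum>i\<in>UNIV. x $ i * cnj (y $ i))"

definition numerical_range :: "complex^'n^'n \<Rightarrow> complex set"
  where "numerical_range A = {cdot (A *v x) x | x. norm x = 1}"

(* The norm on complex^'n is the Euclidean one, so this is the induced operator norm;
   norm A itself would be the Frobenius norm. *)
definition op_norm :: "complex^'n^'n \<Rightarrow> real"
  where "op_norm A = onorm (\<lambda>x. A *v x)"

(* The power operator of the library is componentwise on vectors, hence on matrices. *)
primrec mat_power :: "complex^'n^'n \<Rightarrow> nat \<Rightarrow> complex^'n^'n"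
  where
    "mat_power A 0 = mat 1"
  | "mat_power A (Suc k) = A ** mat_power A k"

definition poly_mat :: "complex poly \<Rightarrow> complex^'n^'n \<Rightarrow> complex^'n^'n"
  where "poly_mat p A = (\<chi> i j. \<Sum>k\<le>degree p. coeff p k * mat_power A k $ i $ j)"

definition A_mat :: "real \<Rightarrow> nat \<Rightarrow> complex^4^4"
  where "A_mat t m = vector
    [vector [0, 1, of_real t, of_real t ^ m],
     vector [0, 0, 1,         of_real t],
     vector [0, 0, 0,         1],
     vector [0, 0, 0,         0]]"

definition t_star :: "nat \<Rightarrow> real"
  where "t_star m = (if m = 2 then 0.363 else if m = 3 then 0.368 else 0.367)"

lemma vector_4 [simp]:
  fixes x y z w :: "'a::zero"
  shows "(vector [x, y, z, w] :: 'a^4) $ 1 = x"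
    and "(vector [x, y, z, w] :: 'a^4) $ 2 = y"
    and "(vector [x, y, z, w] :: 'a^4) $ 3 = z"
    and "(vector [x, y, z, w] :: 'a^4) $ 4 = w"
  by (simp_all add: vector_def)

lemma cdot_self: "cdot x x = of_real ((norm x)\<^sup>2)"
  by (simp add: cdot_def norm_vec_def L2_set_def sum_nonneg complex_norm_square flip: of_real_power)

lemma compact_numerical_range: "compact (numerical_range A)"
proof -
  have "numerical_range A = (\<lambda>x. cdot (A *v x) x) ` sphere 0 1"
    by (auto simp: numerical_range_def)
  moreover have "continuous_on (sphere 0 1) (\<lambda>x. cdot (A *v x) x)"
    unfolding cdot_def matrix_vector_mult_def by (intro continuous_intros)
  ultimately show ?thesis
    by (simp add: compact_continuous_image)
qed

lemma numerical_range_nonempty: "numerical_range A \<noteq> {}"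
proof -
  have "norm (axis undefined 1 :: complex^'n) = 1"
    by simp
  then show ?thesis
    unfolding numerical_range_def by blast
qed

(* The supremum of |p| over the numerical range is a maximum. *)
lemma SUP_numerical_range_attained:
  obtains z where "z \<in> numerical_range A"
    and "\<And>w. w \<in> numerical_range A \<Longrightarrow> norm (poly p w) \<le> norm (poly p z)"
    and "(SUP w\<in>numerical_range A. norm (poly p w)) = norm (poly p z)"
proof -
  have "continuous_on (numerical_range A) (\<lambda>w. norm (poly p w))"
    by (intro continuous_intros)
  then obtain z where z: "z \<in> numerical_range A"
      "\<And>w. w \<in> numerical_range A \<Longrightarrow> norm (poly p w) \<le> norm (poly p z)"
    using continuous_attains_sup[OF compact_numerical_range numerical_range_nonempty] by blast
  moreover have "(SUP w\<in>numerical_range A. norm (poly p w)) = norm (poly p z)"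
    by (rule cSup_eq_maximum) (use z in auto)
  ultimately show ?thesis
    using that by blast
qed

end

theory Submission
  imports Defs
begin

text \<open>
  The matrix is \<open>g(J)\<close> for the nilpotent Jordan block \<open>J\<close> and \<open>g z = z + t z\<^sup>2 + t\<^sup>m z\<^sup>3\<close>. Testing the
  numerical range on the unit vectors \<open>(5, 8 z, 8 z\<^sup>2, 5 z\<^sup>3) / sqrt 178\<close> with \<open>|z| = 1\<close> shows that
  it contains the curve \<open>h z = 72/89 z + 40/89 t z\<^sup>2 + 25/178 t\<^sup>m z\<^sup>3\<close>. As \<open>J\<^sup>4 = 0\<close>, the matrix
  equals \<open>h(T)\<close> for a nilpotent Toeplitz matrix \<open>T\<close>, so \<open>p(A) = (p \<circ> h)(T)\<close>. If \<open>T\<close> is similar to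
  a contraction with condition number at most 2, von Neumann's inequality bounds the norm by twice
  the maximum of \<open>|p|\<close> on the curve. The similarity is given by explicit positive matrices \<open>P\<close> with
  \<open>1 \<le> P \<le> 4\<close> and \<open>T\<^sup>* P T \<le> P\<close>; this condition is convex in \<open>T\<close>, so it suffices to check it at
  the corners of three boxes that cover all parameters.
\<close>

section \<open>Polynomials of a matrix\<close>

lemma mat_power_Suc_mult_vec: "mat_power A (Suc k) *v x = A *v (mat_power A k *v x)"
  by (simp add: matrix_vector_mul_assoc)

lemma poly_mat_mult_vec:
  "poly_mat p A *v x = (\<Sum>k\<le>degree p. coeff p k *s (mat_power A k *v x))"
proof -
  have "(poly_mat p A *v x) $ i = (\<Sum>k\<le>degree p. coeff p k *s (mat_power A k *v x)) $ i" for i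
  proof -
    have "(poly_mat p A *v x) $ i
        = (\<Sum>j\<in>UNIV. \<Sum>k\<le>degree p. coeff p k * (mat_power A k $ i $ j * x $ j))"
      by (simp add: poly_mat_def matrix_vector_mult_def sum_distrib_right mult.assoc)
    also have "\<dots> = (\<Sum>k\<le>degree p. \<Sum>j\<in>UNIV. coeff p k * (mat_power A k $ i $ j * x $ j))"
      by (rule sum.swap)
    finally show ?thesis
      by (simp add: matrix_vector_mult_def sum_distrib_left)
  qed
  then show ?thesis by (simp add: vec_eq_iff)
qed

lemma poly_mat_0_mult_vec [simp]: "poly_mat 0 A *v x = 0"
  by (simp add: poly_mat_mult_vec)

lemma mult_vec_sum: "A *v (\<Sum>k\<in>S. f k) = (\<Sum>k\<in>S. A *v f k)" for A :: "complex^'n^'m"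
  by (induction S rule: infinite_finite_induct) (auto simp: matrix_vector_right_distrib)

text \<open>Horner's rule, which lets the homomorphism properties below go by induction over
  \<open>pCons\<close>.\<close>

lemma poly_mat_pCons_mult_vec [simp]:
  "poly_mat (pCons a p) A *v x = a *s x + A *v (poly_mat p A *v x)"
proof (cases "p = 0")
  case True
  then show ?thesis by (cases "a = 0") (simp_all add: poly_mat_mult_vec)
next
  case False
  then have "poly_mat (pCons a p) A *v x
      = (\<Sum>k\<le>Suc (degree p). coeff (pCons a p) k *s (mat_power A k *v x))"
    by (simp add: poly_mat_mult_vec)
  also have "\<dots> = a *s x + (\<Sum>k\<le>degree p. coeff p k *s (mat_power A (Suc k) *v x))"
    by (subst sum.atMost_Suc_shift) simp
  also have "\<dots> = a *s x + A *v (poly_mat p A *v x)"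
    by (simp only: mat_power_Suc_mult_vec poly_mat_mult_vec mult_vec_sum vector_scalar_commute)
  finally show ?thesis .
qed

lemma poly_mat_add_mult_vec:
  "poly_mat (p + q) A *v x = poly_mat p A *v x + poly_mat q A *v x"
proof (induction p arbitrary: q)
  case (pCons a p)
  show ?case
    by (cases q) (simp add: pCons.IH matrix_vector_right_distrib vector_sadd_rdistrib)
qed simp

lemma poly_mat_smult_mult_vec:
  "poly_mat (smult c p) A *v x = c *s (poly_mat p A *v x)"
  by (induction p) (simp_all add: vector_add_ldistrib vector_scalar_commute vector_smult_assoc)

lemma poly_mat_mult_mult_vec:
  "poly_mat (p * q) A *v x = poly_mat p A *v (poly_mat q A *v x)"
  by (induction p) (simp_all add: poly_mat_add_mult_vec poly_mat_smult_mult_vec)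

lemma poly_mat_pcompose: "poly_mat (pcompose p h) A *v x = poly_mat p (poly_mat h A) *v x"
  by (induction p)
    (simp_all add: pcompose_pCons poly_mat_add_mult_vec poly_mat_mult_mult_vec)

section \<open>Orthogonality of roots of unity\<close>

lemma sum_roots_of_unity_power:
  fixes N :: nat and d :: nat
  assumes "0 < d" "d < N"
  shows "(\<Sum>l<N. cis (2 * pi * real l / real N) ^ d) = 0"
proof -
  \<comment> \<open>De Moivre swaps the roles of \<open>l\<close> and \<open>d\<close>, which makes
    the sum geometric with ratio \<open>w\<close>.\<close>
  define w where "w = cis (2 * pi * real d / real N)"
  have "(\<Sum>l<N. cis (2 * pi * real l / real N) ^ d) = (\<Sum>l<N. w ^ l)"
    unfolding w_def by (intro sum.cong refl) (simp only: Complex.DeMoivre, simp add: mult_ac)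
  moreover have "w ^ N = 1"
  proof -
    have "w ^ N = cis (2 * pi * real d)"
      using assms by (simp add: w_def Complex.DeMoivre)
    also have "\<dots> = 1"
      by (simp add: complex_eq_iff)
    finally show ?thesis .
  qed
  moreover have "w \<noteq> 1"
  proof
    assume "w = 1"
    then have "cos (2 * pi * (real d / real N)) = 1"
      by (simp add: w_def complex_eq_iff)
    then obtain n :: int where "2 * pi * (real d / real N) = n * 2 * pi"
      by (auto simp: cos_one_2pi_int)
    then have "(2 * pi) * (real d / real N) = (2 * pi) * of_int n"
      by (simp only: mult_ac)
    then have "real d / real N = of_int n"
      by (subst (asm) mult_cancel_left) simp
    moreover have "0 < real d / real N" "real d / real N < 1"
      using assms by auto
    ultimately show False by auto
  qed
  ultimately show ?thesis
    by (simp add: sum_gp_strict)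
qed

text \<open>Conjugation inverts points of the unit circle, so only the difference of the exponents
  matters, and it stays below \<open>N\<close>.\<close>

lemma sum_roots_of_unity_orthogonal:
  fixes N :: nat
  assumes "a < N" "b < N"
  shows "(\<Sum>l<N. cis (2 * pi * real l / real N) ^ a * cnj (cis (2 * pi * real l / real N)) ^ b)
    = (if a = b then of_nat N else 0)"
proof -
  define c where "c l = cis (2 * pi * real l / real N)" for l
  have unit: "c l * cnj (c l) = 1" "cnj (c l) * c l = 1" for l
    by (simp_all add: c_def complex_norm_square[symmetric] cis_cnj cis_mult)
  consider "a = b" | "b < a" | "a < b" by linarith
  then show ?thesis
  proof cases
    case 1
    then show ?thesis
      using unit by (simp add: power_mult_distrib[symmetric] c_def)
  next
    case 2
    have "c l ^ a * cnj (c l) ^ b = c l ^ (a - b)" for l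
    proof -
      have "c l ^ a * cnj (c l) ^ b = c l ^ (a - b) * (c l * cnj (c l)) ^ b"
        using 2 by (simp add: power_mult_distrib mult.assoc[symmetric] power_add[symmetric])
      then show ?thesis by (simp add: unit)
    qed
    then show ?thesis
      using 2 assms sum_roots_of_unity_power[of "a - b" N] by (simp add: c_def)
  next
    case 3
    have "c l ^ a * cnj (c l) ^ b = cnj (c l ^ (b - a))" for l
    proof -
      have "c l ^ a * cnj (c l) ^ b = cnj (c l) ^ (b - a) * (c l * cnj (c l)) ^ a"
        using 3 by (simp add: power_mult_distrib mult_ac power_add[symmetric])
      then show ?thesis by (simp add: unit)
    qed
    then have "(\<Sum>l<N. c l ^ a * cnj (c l) ^ b) = cnj (\<Sum>l<N. c l ^ (b - a))"
      by simp
    also have "\<dots> = 0"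
      using 3 assms sum_roots_of_unity_power[of "b - a" N] by (simp only: c_def) simp
    finally show ?thesis
      using 3 by (simp add: c_def)
  qed
qed

section \<open>Von Neumann inequality for nilpotent matrices\<close>

text \<open>Abstracts the inner product given by a symmetric real \<open>P\<close>, for which
  \<open>T\<close> is a contraction.\<close>

locale complex_form =
  fixes B :: "complex^'n \<Rightarrow> complex^'n \<Rightarrow> complex"
  assumes add_left: "B (x + y) z = B x z + B y z"
    and scale_left: "B (c *s x) z = c * B x z"
    and hermitian: "B y x = cnj (B x y)"
begin

lemma add_right: "B x (y + z) = B x y + B x z"
  using hermitian[of x "y + z"] hermitian[of x y] hermitian[of x z] by (simp add: add_left)

lemma scale_right: "B x (c *s y) = cnj c * B x y"
  using hermitian[of x "c *s y"] hermitian[of x y] by (simp add: scale_left)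

lemma diff_left: "B (x - y) z = B x z - B y z"
  using add_left[of "x - y" y z] by simp

lemma diff_right: "B x (y - z) = B x y - B x z"
  using add_right[of x "y - z" z] by simp

lemma zero_left: "B 0 z = 0"
  using add_left[of 0 0 z] by simp

lemma sum_left: "B (\<Sum>k\<in>S. f k) z = (\<Sum>k\<in>S. B (f k) z)"
  by (induction S rule: infinite_finite_induct) (auto simp: add_left zero_left)

lemma Re_self_diff: "Re (B (x - y) (x - y)) = Re (B x x) - 2 * Re (B x y) + Re (B y y)"
  using hermitian[of x y] by (simp add: diff_left diff_right)

lemma Re_self_scale_unit: "norm c = 1 \<Longrightarrow> B (c *s x) (c *s x) = B x x"
  using complex_norm_square[of c] by (simp add: scale_left scale_right mult_ac)

text \<open>
  With \<open>u z = (1 - cnj z T)\<^sup>-\<^sup>1 x\<close> one has \<open>cnj z T (u z) = u z - x\<close>, so the contraction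
  property says that the Herglotz-type form \<open>B (u z) y + B x (v z) - B x y\<close> is positive, where
  \<open>v\<close> is formed from \<open>y\<close>; averaging it against \<open>q\<close> over enough roots of unity produces
  \<open>B (q(T) x) y\<close>.
\<close>
theorem von_Neumann_nilpotent:
  fixes T :: "complex^'n^'n" and q :: "complex poly" and x :: "complex^'n"
  assumes contraction: "\<And>a. Re (B (T *v a) (T *v a)) \<le> Re (B a a)"
    and nilpotent: "mat_power T n = 0"
    and bound: "\<And>z. norm z = 1 \<Longrightarrow> norm (poly q z) \<le> M"
  defines "y \<equiv> poly_mat q T *v x"
  shows "Re (B y y) \<le> M\<^sup>2 * Re (B x x)"
proof -
  \<comment> \<open>\<open>N\<close> exceeds every frequency \<open>k + j\<close> met below, so none
    is aliased to 0.\<close>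
  define N where "N = degree q + n + 1"
  define w where "w l = cis (2 * pi * real l / real N)" for l
  define u where "u z a = (\<Sum>j<n. (cnj z) ^ j *s (mat_power T j *v a))" for z a
  have norm_w: "norm (w l) = 1" for l by (simp add: w_def)
  have N_pos: "0 < N"
    and n_le: "\<And>j. j < n \<Longrightarrow> j < N"
    and deg_le: "\<And>k. k \<le> degree q \<Longrightarrow> k < N"
    and deg_n_le: "\<And>k j. k \<le> degree q \<Longrightarrow> j < n \<Longrightarrow> k + j < N"
    by (simp_all add: N_def)
  \<comment> \<open>Index shift in the finite Neumann series; the new last term vanishes by
    nilpotency.\<close>
  have shift: "cnj z *s (T *v u z a) = u z a - a" for z a
  proof -
    let ?f = "\<lambda>j. (cnj z) ^ j *s (mat_power T j *v a)"
    have "cnj z *s (T *v u z a) = (\<Sum>j<n. ?f (Suc j))"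
      by (simp add: u_def mult_vec_sum vector_scalar_commute vec.scale_sum_right
          vector_smult_assoc matrix_vector_mul_assoc)
    also have "\<dots> = (\<Sum>j<Suc n. ?f j) - ?f 0"
      by (subst sum.lessThan_Suc_shift) simp
    also have "\<dots> = u z a - a"
      by (simp add: u_def nilpotent)
    finally show ?thesis .
  qed
  have T_step: "Re (B (e - d) (e - d)) \<le> Re (B e e)"
    if "cnj z *s (T *v e) = e - d" "norm z = 1" for z e d
  proof -
    have "B (e - d) (e - d) = B (T *v e) (T *v e)"
      using that Re_self_scale_unit[of "cnj z" "T *v e"] by simp
    then show ?thesis using contraction[of e] by simp
  qed
  have pos: "Re (B a a) \<le> 2 * Re (B (u z a) a)" if "norm z = 1" for z a
    using T_step[OF shift that, of a] by (simp add: Re_self_diff)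
  \<comment> \<open>Contraction is applied to \<open>e = c *s u z x - u z y\<close>. By
    \<open>pos\<close> the factor of \<open>(norm c)\<^sup>2\<close> is nonnegative, so
    \<open>norm c\<close> may be replaced by \<open>M\<close>.\<close>
  have pointwise: "2 * Re (c * B (u z x) y + cnj c * B (u z y) x - c * B x y)
      \<le> M\<^sup>2 * (2 * Re (B (u z x) x) - Re (B x x)) + (2 * Re (B (u z y) y) - Re (B y y))"
    if "norm z = 1" "c = poly q z" for z c
  proof -
    define e where "e = c *s u z x - u z y"
    define d where "d = c *s x - y"
    have "cnj z *s (T *v e) = c *s (cnj z *s (T *v u z x)) - cnj z *s (T *v u z y)"
      by (simp add: e_def matrix_vector_mult_diff_distrib vector_scalar_commute
          vector_ssub_ldistrib vector_smult_assoc mult.commute)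
    also have "\<dots> = e - d"
      by (simp add: shift e_def d_def vector_ssub_ldistrib)
    finally have "Re (B d d) \<le> 2 * Re (B e d)"
      using T_step[of z e d] that by (simp add: Re_self_diff)
    moreover have "B e d = of_real ((norm c)\<^sup>2) * B (u z x) x - c * B (u z x) y
        - cnj c * B (u z y) x + B (u z y) y"
      by (simp add: e_def d_def diff_left diff_right scale_left scale_right
          complex_norm_square algebra_simps del: of_real_power)
    moreover have "Re (B d d) = (norm c)\<^sup>2 * Re (B x x) - 2 * Re (c * B x y) + Re (B y y)"
    proof -
      have "B (c *s x) (c *s x) = of_real ((norm c)\<^sup>2) * B x x"
        by (simp add: scale_left scale_right complex_norm_square mult_ac del: of_real_power)
      then show ?thesis
        by (simp add: d_def Re_self_diff scale_left)
    qed
    moreover have "(norm c)\<^sup>2 * (2 * Re (B (u z x) x) - Re (B x x))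
        \<le> M\<^sup>2 * (2 * Re (B (u z x) x) - Re (B x x))"
      using pos[OF that(1), of x] bound[OF that(1)] that(2)
      by (intro mult_right_mono power_mono) auto
    ultimately show ?thesis
      by (simp add: algebra_simps)
  qed
  have ortho: "(\<Sum>l<N. w l ^ a * cnj (w l) ^ b) = (if a = b then of_nat N else 0)"
    if "a < N" "b < N" for a b
    using sum_roots_of_unity_orthogonal[OF that] by (simp add: w_def)
  have poly_w: "poly q z = (\<Sum>k\<le>degree q. coeff q k * z ^ k)" for z
    by (simp add: poly_altdef)
  have B_u: "B (u z a) b = (\<Sum>j<n. cnj z ^ j * B (mat_power T j *v a) b)" for z a b
    by (simp add: u_def sum_left scale_left)
  have avg_q: "(\<Sum>l<N. poly q (w l) * cnj (w l) ^ j) = of_nat N * coeff q j" if "j < N" for j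
  proof -
    have "(\<Sum>l<N. poly q (w l) * cnj (w l) ^ j)
        = (\<Sum>l<N. \<Sum>k\<le>degree q. coeff q k * (w l ^ k * cnj (w l) ^ j))"
      by (simp add: poly_w sum_distrib_right mult.assoc)
    also have "\<dots> = (\<Sum>k\<le>degree q. coeff q k * (\<Sum>l<N. w l ^ k * cnj (w l) ^ j))"
      by (subst sum.swap) (simp add: sum_distrib_left)
    also have "\<dots> = (\<Sum>k\<le>degree q. if k = j then of_nat N * coeff q k else 0)"
      using that by (intro sum.cong refl) (auto simp: ortho deg_le)
    also have "\<dots> = of_nat N * coeff q j"
      by (auto simp: coeff_eq_0)
    finally show ?thesis .
  qed
  \<comment> \<open>No conjugate occurs here, so only \<open>k = j = 0\<close> has a nonzero
    mean.\<close>
  have avg_q': "(\<Sum>l<N. poly q (w l) * w l ^ j) = (if j = 0 then of_nat N * coeff q 0 else 0)"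
    if "j < n" for j
  proof -
    have "(\<Sum>l<N. poly q (w l) * w l ^ j)
        = (\<Sum>l<N. \<Sum>k\<le>degree q. coeff q k * (w l ^ (k + j) * cnj (w l) ^ 0))"
      by (simp add: poly_w sum_distrib_right power_add mult.assoc)
    also have "\<dots> = (\<Sum>k\<le>degree q. coeff q k * (\<Sum>l<N. w l ^ (k + j) * cnj (w l) ^ 0))"
      by (subst sum.swap) (simp only: sum_distrib_left)
    also have "\<dots> = (\<Sum>k\<le>degree q. if k = 0 \<and> j = 0 then of_nat N * coeff q k else 0)"
      using that N_pos by (intro sum.cong refl, subst ortho) (auto simp: deg_n_le)
    also have "\<dots> = (if j = 0 then of_nat N * coeff q 0 else 0)"
      by (cases "j = 0") simp_all
    finally show ?thesis .
  qed
  have T_n: "mat_power T k *v a = 0" if "n \<le> k" for k a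
    using that by (induction k rule: dec_induct)
      (simp_all add: nilpotent matrix_vector_mul_assoc[symmetric])
  have y_eq: "y = (\<Sum>j<n. coeff q j *s (mat_power T j *v x))"
  proof -
    have "y = (\<Sum>j<N. coeff q j *s (mat_power T j *v x))"
      unfolding y_def poly_mat_mult_vec
      by (intro sum.mono_neutral_left) (auto simp: N_def coeff_eq_0)
    also have "\<dots> = (\<Sum>j<n. coeff q j *s (mat_power T j *v x))"
      by (intro sum.mono_neutral_right) (auto simp: N_def T_n)
    finally show ?thesis .
  qed
  have avg1: "(\<Sum>l<N. poly q (w l) * B (u (w l) x) b) = of_nat N * B y b" for b
  proof -
    have "(\<Sum>l<N. poly q (w l) * B (u (w l) x) b)
        = (\<Sum>j<n. B (mat_power T j *v x) b * (\<Sum>l<N. poly q (w l) * cnj (w l) ^ j))"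
      by (subst sum_distrib_left, subst sum.swap) (simp add: B_u sum_distrib_left mult_ac)
    also have "\<dots> = of_nat N * B y b"
      by (simp add: avg_q n_le y_eq sum_left scale_left sum_distrib_left mult_ac)
    finally show ?thesis .
  qed
  \<comment> \<open>If \<open>n = 0\<close>, nilpotency makes the identity matrix zero, which forces
    \<open>a = 0\<close>.\<close>
  have ident: "(\<Sum>j<n. (if j = 0 then c else 0) * f (mat_power T j *v a)) = c * f a"
    if "f 0 = 0" for a and f :: "complex^'n \<Rightarrow> complex" and c
  proof (cases "n = 0")
    case True
    then have "a = 0" using T_n[of 0 a] by simp
    then show ?thesis using True that by simp
  next
    case False
    have "(\<Sum>j<n. (if j = 0 then c else 0) * f (mat_power T j *v a))
        = (\<Sum>j<n. if j = 0 then c * f a else 0)"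
      by (intro sum.cong) auto
    then show ?thesis using False by simp
  qed
  have avg2: "(\<Sum>l<N. B (u (w l) a) b) = of_nat N * B a b" for a b
  proof -
    have "(\<Sum>l<N. B (u (w l) a) b)
        = (\<Sum>j<n. (\<Sum>l<N. w l ^ 0 * cnj (w l) ^ j) * B (mat_power T j *v a) b)"
      by (subst sum_distrib_right, subst sum.swap) (simp add: B_u)
    also have "\<dots> = (\<Sum>j<n. (if j = 0 then of_nat N else 0) * B (mat_power T j *v a) b)"
      using N_pos by (intro sum.cong refl, subst ortho) (auto simp: n_le)
    finally show ?thesis by (simp add: ident[where f = "\<lambda>a. B a b"] zero_left)
  qed
  have avg3: "(\<Sum>l<N. cnj (poly q (w l)) * B (u (w l) y) x)
      = of_nat N * cnj (coeff q 0) * B y x"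
  proof -
    have "(\<Sum>l<N. cnj (poly q (w l)) * B (u (w l) y) x)
        = (\<Sum>j<n. cnj (\<Sum>l<N. poly q (w l) * w l ^ j) * B (mat_power T j *v y) x)"
      unfolding cnj_sum
      by (subst sum_distrib_right, subst sum.swap) (simp add: B_u sum_distrib_left mult_ac)
    also have "\<dots> = (\<Sum>j<n. (if j = 0 then of_nat N * cnj (coeff q 0) else 0)
        * B (mat_power T j *v y) x)"
      by (intro sum.cong refl) (auto simp: avg_q')
    finally show ?thesis by (simp add: ident[where f = "\<lambda>a. B a x"] zero_left)
  qed
  have avg4: "(\<Sum>l<N. poly q (w l) * B x y) = of_nat N * coeff q 0 * B x y"
    using avg_q[of 0] N_pos by (simp add: sum_distrib_right[symmetric])
  \<comment> \<open>After averaging, the two terms with \<open>coeff q 0\<close> have equal real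
    parts and cancel; the right-hand side then absorbs one of the two copies of
    \<open>Re (B y y)\<close>.\<close>
  have "(\<Sum>l<N. 2 * Re (poly q (w l) * B (u (w l) x) y + cnj (poly q (w l)) * B (u (w l) y) x
        - poly q (w l) * B x y))
      \<le> (\<Sum>l<N. M\<^sup>2 * (2 * Re (B (u (w l) x) x) - Re (B x x))
        + (2 * Re (B (u (w l) y) y) - Re (B y y)))"
    by (intro sum_mono pointwise norm_w refl)
  also have "(\<Sum>l<N. 2 * Re (poly q (w l) * B (u (w l) x) y
        + cnj (poly q (w l)) * B (u (w l) y) x - poly q (w l) * B x y))
      = 2 * Re (of_nat N * B y y + of_nat N * cnj (coeff q 0) * B y x
        - of_nat N * coeff q 0 * B x y)"
    by (simp only: avg1[symmetric] avg3[symmetric] avg4[symmetric] sum_distrib_left[symmetric]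
        Re_sum[symmetric] sum.distrib sum_subtractf)
  also have "\<dots> = 2 * (real N * Re (B y y))"
  proof -
    have "cnj (coeff q 0) * B y x = cnj (coeff q 0 * B x y)"
      by (simp add: hermitian[of y x])
    then have "Re (cnj (coeff q 0) * B y x) = Re (coeff q 0 * B x y)"
      by (simp only: cnj.sel)
    then have "real N * Re (cnj (coeff q 0) * B y x) = real N * Re (coeff q 0 * B x y)"
      by simp
    then show ?thesis
      by (simp add: mult.assoc)
  qed
  also have "(\<Sum>l<N. M\<^sup>2 * (2 * Re (B (u (w l) x) x) - Re (B x x))
        + (2 * Re (B (u (w l) y) y) - Re (B y y)))
      = M\<^sup>2 * (2 * Re (\<Sum>l<N. B (u (w l) x) x) - real N * Re (B x x))
        + (2 * Re (\<Sum>l<N. B (u (w l) y) y) - real N * Re (B y y))"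
    by (simp add: sum.distrib sum_subtractf sum_distrib_left[symmetric])
  also have "\<dots> = real N * (M\<^sup>2 * Re (B x x) + Re (B y y))"
    by (simp add: avg2 algebra_simps)
  finally have "real N * (2 * Re (B y y)) \<le> real N * (M\<^sup>2 * Re (B x x) + Re (B y y))"
    by simp
  then show ?thesis using N_pos by simp
qed

end

section \<open>Real matrices similar to a contraction\<close>

text \<open>For real \<open>P\<close> and \<open>T\<close> the form splits over real and imaginary
  parts, so conditions on real vectors suffice.\<close>

definition Re_vec :: "complex^'n \<Rightarrow> real^'n" where "Re_vec x = (\<chi> i. Re (x $ i))"
definition Im_vec :: "complex^'n \<Rightarrow> real^'n" where "Im_vec x = (\<chi> i. Im (x $ i))"
definition of_real_mat :: "real^'n^'m \<Rightarrow> complex^'n^'m"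
  where "of_real_mat A = (\<chi> i j. of_real (A $ i $ j))"

lemma norm_Re_Im_vec: "(norm x)\<^sup>2 = (norm (Re_vec x))\<^sup>2 + (norm (Im_vec x))\<^sup>2"
  by (simp add: norm_vec_def L2_set_def sum_nonneg Re_vec_def Im_vec_def cmod_power2 sum.distrib)

lemma Re_vec_mult: "Re_vec (of_real_mat A *v x) = A *v Re_vec x"
  and Im_vec_mult: "Im_vec (of_real_mat A *v x) = A *v Im_vec x"
  by (simp_all add: vec_eq_iff Re_vec_def Im_vec_def of_real_mat_def matrix_vector_mult_def)

definition quad_form :: "real^'n^'n \<Rightarrow> real^'n \<Rightarrow> real"
  where "quad_form P v = v \<bullet> (P *v v)"

lemma cdot_add_left: "cdot (x + y) z = cdot x z + cdot y z"
  and cdot_scale_left: "cdot (c *s x) z = c * cdot x z"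
  by (simp_all add: cdot_def algebra_simps sum.distrib sum_distrib_left)

lemma Re_cdot_of_real_mat:
  "Re (cdot (of_real_mat P *v x) x) = quad_form P (Re_vec x) + quad_form P (Im_vec x)"
  by (simp add: cdot_def quad_form_def inner_vec_def matrix_vector_mult_def Re_vec_def Im_vec_def
      of_real_mat_def sum.distrib sum_distrib_left sum_distrib_right algebra_simps)

lemma complex_form_of_real_mat:
  fixes P :: "real^'n^'n"
  assumes "transpose P = P"
  shows "complex_form (\<lambda>x y. cdot (of_real_mat P *v x) y)"
proof
  fix x y :: "complex^'n"
  have P: "P $ i $ j = P $ j $ i" for i j
    using assms by (metis transpose_def vec_lambda_beta)
  have "cnj (cdot (of_real_mat P *v x) y)
      = (\<Sum>i\<in>UNIV. \<Sum>j\<in>UNIV. of_real (P $ i $ j) * cnj (x $ j) * y $ i)"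
    by (simp add: cdot_def matrix_vector_mult_def of_real_mat_def sum_distrib_right)
  also have "\<dots> = (\<Sum>j\<in>UNIV. \<Sum>i\<in>UNIV. of_real (P $ i $ j) * cnj (x $ j) * y $ i)"
    by (rule sum.swap)
  also have "\<dots> = cdot (of_real_mat P *v y) x"
    by (simp add: cdot_def matrix_vector_mult_def of_real_mat_def sum_distrib_left sum_distrib_right
        P[of _ j for j] mult_ac)
  finally show "cdot (of_real_mat P *v y) x = cnj (cdot (of_real_mat P *v x) y)"
    by simp
qed (simp_all add: matrix_vector_right_distrib vector_scalar_commute cdot_add_left cdot_scale_left)

text \<open>The similarity is the square root of \<open>P\<close>, whose condition number is at most \<open>K\<close>.\<close>

definition similar_to_contraction :: "real \<Rightarrow> real^'n^'n \<Rightarrow> bool"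
  where "similar_to_contraction K T \<longleftrightarrow> (\<exists>P. transpose P = P
    \<and> (\<forall>v. (norm v)\<^sup>2 \<le> quad_form P v) \<and> (\<forall>v. quad_form P v \<le> K\<^sup>2 * (norm v)\<^sup>2)
    \<and> (\<forall>v. quad_form P (T *v v) \<le> quad_form P v))"

text \<open>Von Neumann's inequality holds in the norm given by \<open>P\<close>; passing to that
  norm and back costs the factor \<open>K\<close>.\<close>

lemma norm_poly_mat_le:
  fixes T :: "real^'n^'n" and q :: "complex poly"
  assumes "similar_to_contraction K T"
    and nilpotent: "mat_power (of_real_mat T) n = 0"
    and bound: "\<And>z. norm z = 1 \<Longrightarrow> norm (poly q z) \<le> M"
    and "0 \<le> K"
  shows "norm (poly_mat q (of_real_mat T) *v x) \<le> K * M * norm x"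
proof -
  obtain P where sym: "transpose P = P"
    and lower: "\<And>v. (norm v)\<^sup>2 \<le> quad_form P v"
    and upper: "\<And>v. quad_form P v \<le> K\<^sup>2 * (norm v)\<^sup>2"
    and contraction: "\<And>v. quad_form P (T *v v) \<le> quad_form P v"
    using assms(1) unfolding similar_to_contraction_def by blast
  interpret complex_form "\<lambda>x y. cdot (of_real_mat P *v x) y"
    by (rule complex_form_of_real_mat[OF sym])
  define y where "y = poly_mat q (of_real_mat T) *v x"
  have "0 \<le> M"
    using order_trans[OF norm_ge_zero bound[of 1]] by simp
  have "(norm y)\<^sup>2 \<le> Re (cdot (of_real_mat P *v y) y)"
    using lower[of "Re_vec y"] lower[of "Im_vec y"]
    by (simp add: Re_cdot_of_real_mat norm_Re_Im_vec)
  also have "\<dots> \<le> M\<^sup>2 * Re (cdot (of_real_mat P *v x) x)"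
    unfolding y_def
  proof (rule von_Neumann_nilpotent[OF _ nilpotent bound])
    fix a :: "complex^'n"
    show "Re (cdot (of_real_mat P *v (of_real_mat T *v a)) (of_real_mat T *v a))
        \<le> Re (cdot (of_real_mat P *v a) a)"
      using contraction[of "Re_vec a"] contraction[of "Im_vec a"]
      by (simp add: Re_cdot_of_real_mat Re_vec_mult Im_vec_mult)
  qed
  also have "\<dots> \<le> M\<^sup>2 * (K\<^sup>2 * (norm x)\<^sup>2)"
    using upper[of "Re_vec x"] upper[of "Im_vec x"]
    by (intro mult_left_mono) (simp_all add: Re_cdot_of_real_mat norm_Re_Im_vec distrib_left)
  also have "\<dots> = (K * M * norm x)\<^sup>2"
    by (simp add: power_mult_distrib mult_ac)
  finally show ?thesis
    using \<open>0 \<le> K\<close> \<open>0 \<le> M\<close> by (simp add: y_def power2_le_iff_abs_le)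
qed

section \<open>Toeplitz matrices of size four\<close>

lemma quad2_nonneg:
  fixes a b c x y :: real
  assumes "0 < a" "b\<^sup>2 \<le> a * c"
  shows "0 \<le> a * x\<^sup>2 + 2 * b * x * y + c * y\<^sup>2"
proof -
  have "a * (a * x\<^sup>2 + 2 * b * x * y + c * y\<^sup>2) = (a * x + b * y)\<^sup>2 + (a * c - b\<^sup>2) * y\<^sup>2"
    by (simp add: power2_eq_square algebra_simps)
  also have "0 \<le> \<dots>" using assms by simp
  finally show ?thesis using assms by (simp add: zero_le_mult_iff)
qed

text \<open>Multiplying by the pivot \<open>a\<close> and completing the square in \<open>x\<close>
  leaves the Schur complement in \<open>y\<close> and \<open>z\<close>.\<close>

lemma quad3_nonneg:
  fixes a b c d e f x y z :: real
  assumes "0 < a" "b\<^sup>2 < a * d" "(a * e - b * c)\<^sup>2 \<le> (a * d - b\<^sup>2) * (a * f - c\<^sup>2)"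
  shows "0 \<le> a * x\<^sup>2 + 2 * b * x * y + 2 * c * x * z + d * y\<^sup>2 + 2 * e * y * z + f * z\<^sup>2"
    (is "0 \<le> ?q")
proof -
  have "a * ?q = (a * x + b * y + c * z)\<^sup>2
      + ((a * d - b\<^sup>2) * y\<^sup>2 + 2 * (a * e - b * c) * y * z + (a * f - c\<^sup>2) * z\<^sup>2)"
    by (simp add: power2_eq_square algebra_simps)
  moreover have "0 \<le> (a * d - b\<^sup>2) * y\<^sup>2 + 2 * (a * e - b * c) * y * z + (a * f - c\<^sup>2) * z\<^sup>2"
    using assms by (intro quad2_nonneg) auto
  ultimately have "0 \<le> a * ?q" by simp
  then show ?thesis using assms by (simp add: zero_le_mult_iff)
qed

text \<open>
  Positivity of the pivots of successive Schur complements, cleared of denominators. The form below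
  has no \<open>x z\<close> and \<open>x w\<close> terms.
\<close>

definition pos4 :: "real \<Rightarrow> real \<Rightarrow> real \<Rightarrow> real \<Rightarrow> real \<Rightarrow> real \<Rightarrow> real \<Rightarrow> real \<Rightarrow> bool"
  where "pos4 a b c d e f g h \<longleftrightarrow> 0 < a \<and> b\<^sup>2 < a * c \<and> (a * d)\<^sup>2 < (a * c - b\<^sup>2) * (a * f) \<and>
    ((a * c - b\<^sup>2) * (a * g) - a * d * (a * e))\<^sup>2
      \<le> ((a * c - b\<^sup>2) * (a * f) - (a * d)\<^sup>2) * ((a * c - b\<^sup>2) * (a * h) - (a * e)\<^sup>2)"

lemma quad4_nonneg:
  fixes a b c d e f g h x y z w :: real
  assumes "pos4 a b c d e f g h"
  shows "0 \<le> a * x\<^sup>2 + 2 * b * x * y + c * y\<^sup>2 + 2 * d * y * z + 2 * e * y * w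
    + f * z\<^sup>2 + 2 * g * z * w + h * w\<^sup>2" (is "0 \<le> ?q")
proof -
  have "a * ?q = (a * x + b * y)\<^sup>2 + ((a * c - b\<^sup>2) * y\<^sup>2 + 2 * (a * d) * y * z + 2 * (a * e) * y * w
      + (a * f) * z\<^sup>2 + 2 * (a * g) * z * w + (a * h) * w\<^sup>2)"
    by (simp add: power2_eq_square algebra_simps)
  moreover have "0 \<le> (a * c - b\<^sup>2) * y\<^sup>2 + 2 * (a * d) * y * z + 2 * (a * e) * y * w
      + (a * f) * z\<^sup>2 + 2 * (a * g) * z * w + (a * h) * w\<^sup>2"
    using assms unfolding pos4_def by (intro quad3_nonneg) auto
  ultimately have "0 \<le> a * ?q" by simp
  then show ?thesis using assms by (simp add: pos4_def zero_le_mult_iff)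
qed

text \<open>Convexity as an identity: the gap at \<open>s\<close>, times \<open>s1 - s0\<close>, is
  a nonnegative combination of the gaps at the ends plus a nonnegative multiple of
  \<open>a\<close>.\<close>

lemma quadratic_le_between:
  fixes a b c K s s0 s1 :: real
  assumes "0 \<le> a" "s0 < s1" "s0 \<le> s" "s \<le> s1"
    and "a * s0\<^sup>2 + b * s0 + c \<le> K" "a * s1\<^sup>2 + b * s1 + c \<le> K"
  shows "a * s\<^sup>2 + b * s + c \<le> K"
proof -
  have "(s1 - s0) * (K - (a * s\<^sup>2 + b * s + c))
      = (s1 - s) * (K - (a * s0\<^sup>2 + b * s0 + c)) + (s - s0) * (K - (a * s1\<^sup>2 + b * s1 + c))
        + a * ((s1 - s0) * (s - s0) * (s1 - s))"
    by (simp add: power2_eq_square algebra_simps)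
  also have "0 \<le> \<dots>"
    using assms by (intro add_nonneg_nonneg mult_nonneg_nonneg) auto
  finally show ?thesis
    using assms by (simp add: zero_le_mult_iff)
qed

text \<open>The matrix a J + b J^2 + c J^3 for the nilpotent Jordan block J.\<close>

definition toep4 :: "'a::zero \<Rightarrow> 'a \<Rightarrow> 'a \<Rightarrow> 'a^4^4"
  where "toep4 a b c = vector [vector [0, a, b, c], vector [0, 0, a, b], vector [0, 0, 0, a],
    vector [0, 0, 0, 0]]"

lemma toep4_mult_vec [simp]:
  fixes a b c :: "'a::comm_semiring_1"
  shows "(toep4 a b c *v x) $ 1 = a * x $ 2 + b * x $ 3 + c * x $ 4"
    and "(toep4 a b c *v x) $ 2 = a * x $ 3 + b * x $ 4"
    and "(toep4 a b c *v x) $ 3 = a * x $ 4"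
    and "(toep4 a b c *v x) $ 4 = 0"
  by (simp_all add: toep4_def matrix_vector_mult_def sum_4)

lemma A_mat_eq_toep4: "A_mat t m = toep4 1 (of_real t) (of_real t ^ m)"
  by (simp add: A_mat_def toep4_def)

lemma of_real_mat_toep4: "of_real_mat (toep4 a b c) = toep4 (of_real a) (of_real b) (of_real c)"
  by (simp add: of_real_mat_def toep4_def vec_eq_iff forall_4)

lemma toep4_nilpotent: "mat_power (toep4 a b c) 4 = 0"
proof -
  have "mat_power (toep4 a b c) 4 *v x = 0" for x :: "complex^4"
    by (simp add: numeral_eq_Suc vec_eq_iff forall_4 matrix_vector_mul_assoc[symmetric])
  then show ?thesis by (simp add: matrix_eq)
qed

text \<open>The image of a \<open>toep4\<close> matrix does not involve the first coordinate of the
  argument, so with these zeros in the first row P - T* P T also has the shape that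
  \<open>pos4\<close> handles.\<close>

definition weight :: "real \<Rightarrow> real \<Rightarrow> real \<Rightarrow> real \<Rightarrow> real \<Rightarrow> real \<Rightarrow> real \<Rightarrow> real^4^4"
  where "weight p1 p2 p3 p4 a d e = vector [vector [p1, a, 0, 0], vector [a, p2, 0, e],
    vector [0, 0, p3, d], vector [0, e, d, p4]]"

lemma transpose_weight: "transpose (weight p1 p2 p3 p4 a d e) = weight p1 p2 p3 p4 a d e"
  by (simp add: transpose_def weight_def vec_eq_iff forall_4)

lemma quad_form_weight:
  "quad_form (weight p1 p2 p3 p4 a d e) v = p1 * (v$1)\<^sup>2 + 2 * a * v$1 * v$2 + p2 * (v$2)\<^sup>2
    + 2 * 0 * v$2 * v$3 + 2 * e * v$2 * v$4 + p3 * (v$3)\<^sup>2 + 2 * d * v$3 * v$4 + p4 * (v$4)\<^sup>2"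
  by (simp add: quad_form_def weight_def inner_vec_def matrix_vector_mult_def sum_4
      power2_eq_square algebra_simps)

lemma norm_vec4: "(norm v)\<^sup>2 = (v$1)\<^sup>2 + (v$2)\<^sup>2 + (v$3)\<^sup>2 + (v$4)\<^sup>2" for v :: "real^4"
  by (simp add: norm_vec_def L2_set_def sum_nonneg sum_4)

definition contraction_cond ::
    "real \<Rightarrow> real \<Rightarrow> real \<Rightarrow> real \<Rightarrow> real \<Rightarrow> real \<Rightarrow> real \<Rightarrow> real \<Rightarrow> real \<Rightarrow> real \<Rightarrow> bool"
  where "contraction_cond p1 p2 p3 p4 a d e k1 k2 k3 \<longleftrightarrow>
    pos4 p1 a (p2 - p1 * k1\<^sup>2) (- (p1 * k1 * k2 + a * k1\<^sup>2)) (e - p1 * k1 * k3 - a * k1 * k2)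
      (p3 - p1 * k2\<^sup>2 - 2 * a * k1 * k2 - p2 * k1\<^sup>2)
      (d - p1 * k2 * k3 - a * (k1 * k3 + k2\<^sup>2) - p2 * k1 * k2)
      (p4 - p1 * k3\<^sup>2 - 2 * a * k2 * k3 - p2 * k2\<^sup>2 - p3 * k1\<^sup>2)"

lemma quad_form_toep4_le:
  assumes "contraction_cond p1 p2 p3 p4 a d e k1 k2 k3"
  shows "quad_form (weight p1 p2 p3 p4 a d e) (toep4 k1 k2 k3 *v v)
    \<le> quad_form (weight p1 p2 p3 p4 a d e) v"
proof -
  have "quad_form (weight p1 p2 p3 p4 a d e) v
      - quad_form (weight p1 p2 p3 p4 a d e) (toep4 k1 k2 k3 *v v)
    = p1 * (v$1)\<^sup>2 + 2 * a * v$1 * v$2 + (p2 - p1 * k1\<^sup>2) * (v$2)\<^sup>2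
    + 2 * (- (p1 * k1 * k2 + a * k1\<^sup>2)) * v$2 * v$3
    + 2 * (e - p1 * k1 * k3 - a * k1 * k2) * v$2 * v$4
    + (p3 - p1 * k2\<^sup>2 - 2 * a * k1 * k2 - p2 * k1\<^sup>2) * (v$3)\<^sup>2
    + 2 * (d - p1 * k2 * k3 - a * (k1 * k3 + k2\<^sup>2) - p2 * k1 * k2) * v$3 * v$4
    + (p4 - p1 * k3\<^sup>2 - 2 * a * k2 * k3 - p2 * k2\<^sup>2 - p3 * k1\<^sup>2) * (v$4)\<^sup>2"
    unfolding quad_form_weight toep4_mult_vec by (simp add: power2_eq_square algebra_simps)
  also have "0 \<le> \<dots>"
    using assms unfolding contraction_cond_def by (rule quad4_nonneg)
  finally show ?thesis by simp
qed

lemma quad_form_weight_ge: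
  assumes "pos4 (p1 - 1) a (p2 - 1) 0 e (p3 - 1) d (p4 - 1)"
  shows "(norm v)\<^sup>2 \<le> quad_form (weight p1 p2 p3 p4 a d e) v"
proof -
  have "0 \<le> (p1 - 1) * (v$1)\<^sup>2 + 2 * a * v$1 * v$2 + (p2 - 1) * (v$2)\<^sup>2
    + 2 * 0 * v$2 * v$3 + 2 * e * v$2 * v$4 + (p3 - 1) * (v$3)\<^sup>2 + 2 * d * v$3 * v$4
    + (p4 - 1) * (v$4)\<^sup>2"
    using assms by (rule quad4_nonneg)
  then show ?thesis by (simp add: quad_form_weight norm_vec4 algebra_simps)
qed

lemma quad_form_weight_le:
  assumes "pos4 (K - p1) (- a) (K - p2) 0 (- e) (K - p3) (- d) (K - p4)"
  shows "quad_form (weight p1 p2 p3 p4 a d e) v \<le> K * (norm v)\<^sup>2"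
proof -
  have "0 \<le> (K - p1) * (v$1)\<^sup>2 + 2 * (- a) * v$1 * v$2 + (K - p2) * (v$2)\<^sup>2
    + 2 * 0 * v$2 * v$3 + 2 * (- e) * v$2 * v$4 + (K - p3) * (v$3)\<^sup>2 + 2 * (- d) * v$3 * v$4
    + (K - p4) * (v$4)\<^sup>2"
    using assms by (rule quad4_nonneg)
  then show ?thesis by (simp add: quad_form_weight norm_vec4 algebra_simps)
qed

text \<open>The vector \<open>toep4 k1 k2 k3 *v v\<close> is affine in \<open>k2\<close> and in
  \<open>k3\<close>, so its form is a convex quadratic in each. Interpolating in \<open>k2\<close>
  and then in \<open>k3\<close> leaves the four corners.\<close>

lemma quad_form_toep4_between:
  fixes a b :: real
  assumes nonneg: "\<And>v. 0 \<le> quad_form P v"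
    and k2: "x0 < x1" "x0 \<le> k2" "k2 \<le> x1"
    and k3: "y0 < y1" "y0 \<le> k3" "k3 \<le> y1"
    and "quad_form P (toep4 k1 x0 y0 *v v) \<le> K" "quad_form P (toep4 k1 x0 y1 *v v) \<le> K"
    and "quad_form P (toep4 k1 x1 y0 *v v) \<le> K" "quad_form P (toep4 k1 x1 y1 *v v) \<le> K"
  shows "quad_form P (toep4 k1 k2 k3 *v v) \<le> K"
proof -
  have expand: "quad_form P (u + s *\<^sub>R u') = quad_form P u' * s\<^sup>2
      + (u \<bullet> (P *v u') + u' \<bullet> (P *v u)) * s + quad_form P u" for u u' s
    by (simp add: quad_form_def matrix_vector_right_distrib inner_add_left inner_add_right
        matrix_vector_mult_scaleR power2_eq_square algebra_simps)
  have interpolate: "quad_form P (u + s *\<^sub>R u') \<le> K"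
    if "s0 < s1" "s0 \<le> s" "s \<le> s1"
      "quad_form P (u + s0 *\<^sub>R u') \<le> K" "quad_form P (u + s1 *\<^sub>R u') \<le> K" for u u' s s0 s1
    using that(4,5) unfolding expand by (rule quadratic_le_between[OF nonneg that(1-3)])
  have in_k2: "toep4 k1 s r *v v = toep4 k1 0 r *v v + s *\<^sub>R (toep4 0 1 0 *v v)"
    and in_k3: "toep4 k1 r s *v v = toep4 k1 r 0 *v v + s *\<^sub>R (toep4 0 0 1 *v v)" for s r
    by (simp_all add: vec_eq_iff forall_4 algebra_simps)
  have edge: "quad_form P (toep4 k1 k2 y *v v) \<le> K"
    if "quad_form P (toep4 k1 x0 y *v v) \<le> K" "quad_form P (toep4 k1 x1 y *v v) \<le> K" for y
    using interpolate[OF k2, of "toep4 k1 0 y *v v" "toep4 0 1 0 *v v"] that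
    by (simp only: in_k2[symmetric])
  show ?thesis
    using interpolate[OF k3, of "toep4 k1 k2 0 *v v" "toep4 0 0 1 *v v"]
      edge[OF assms(8,10)] edge[OF assms(9,11)]
    by (simp only: in_k3[symmetric])
qed

section \<open>The similarity and the numerical range\<close>

lemma similar_to_contraction_box:
  assumes lower: "pos4 (p1 - 1) a (p2 - 1) 0 e (p3 - 1) d (p4 - 1)"
    and upper: "pos4 (4 - p1) (- a) (4 - p2) 0 (- e) (4 - p3) (- d) (4 - p4)"
    and k2: "x0 < x1" "x0 \<le> k2" "k2 \<le> x1"
    and k3: "y0 < y1" "y0 \<le> k3" "k3 \<le> y1"
    and "contraction_cond p1 p2 p3 p4 a d e k1 x0 y0" "contraction_cond p1 p2 p3 p4 a d e k1 x0 y1"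
    and "contraction_cond p1 p2 p3 p4 a d e k1 x1 y0" "contraction_cond p1 p2 p3 p4 a d e k1 x1 y1"
  shows "similar_to_contraction 2 (toep4 k1 k2 k3)"
unfolding similar_to_contraction_def
proof (intro exI conjI allI)
  fix v
  show "(norm v)\<^sup>2 \<le> quad_form (weight p1 p2 p3 p4 a d e) v"
    by (rule quad_form_weight_ge[OF lower])
  show "quad_form (weight p1 p2 p3 p4 a d e) v \<le> 2\<^sup>2 * (norm v)\<^sup>2"
    using quad_form_weight_le[OF upper] by simp
  show "quad_form (weight p1 p2 p3 p4 a d e) (toep4 k1 k2 k3 *v v)
      \<le> quad_form (weight p1 p2 p3 p4 a d e) v"
  proof (rule quad_form_toep4_between[OF _ k2 k3])
    show "0 \<le> quad_form (weight p1 p2 p3 p4 a d e) v" for v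
      using quad_form_weight_ge[OF lower, of v] zero_le_power2[of "norm v"] by linarith
  qed (use assms in \<open>simp_all add: quad_form_toep4_le\<close>)
qed (rule transpose_weight)

text \<open>
  The entries of the weights below were found by numerical semidefinite optimisation.
\<close>

lemma similar_to_contraction_small_t:
  assumes "0 \<le> k2" "k2 \<le> 853/10000" "-258/10000 \<le> k3" "k3 \<le> 183/10000"
  shows "similar_to_contraction 2 (toep4 (89/72) k2 k3)"
  by (rule similar_to_contraction_box[where ?p1.0 = "201/200" and ?p2.0 = "159/100" and ?p3.0 = "253/100"
        and ?p4.0 = "399/100" and a = "-7/200" and d = "17/200" and e = "1/25",
        OF _ _ _ assms(1,2) _ assms(3,4)])
    (simp_all add: pos4_def contraction_cond_def power2_eq_square)

lemma similar_to_contraction_quadratic: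
  assumes "851/10000 \<le> k2" "k2 \<le> 1406/10000" "182/10000 \<le> k3" "k3 \<le> 496/10000"
  shows "similar_to_contraction 2 (toep4 (89/72) k2 k3)"
  by (rule similar_to_contraction_box[where ?p1.0 = "51/50" and ?p2.0 = "161/100" and ?p3.0 = "503/200"
        and ?p4.0 = "99/25" and a = "-9/100" and d = "9/40" and e = "3/50",
        OF _ _ _ assms(1,2) _ assms(3,4)])
    (simp_all add: pos4_def contraction_cond_def power2_eq_square)

lemma similar_to_contraction_higher:
  assumes "851/10000 \<le> k2" "k2 \<le> 1426/10000" "-555/10000 \<le> k3" "k3 \<le> -95/10000"
  shows "similar_to_contraction 2 (toep4 (89/72) k2 k3)"
  by (rule similar_to_contraction_box[where ?p1.0 = "203/200" and ?p2.0 = "321/200" and ?p3.0 = "251/100"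
        and ?p4.0 = "99/25" and a = "-19/200" and d = "23/100" and e = "-1/40",
        OF _ _ _ assms(1,2) _ assms(3,4)])
    (simp_all add: pos4_def contraction_cond_def power2_eq_square)

text \<open>
  The entries \<open>k1 = 89/72\<close>, \<open>k2\<close>, \<open>k3\<close> are the first three Taylor coefficients at 0 of
  \<open>h\<^sup>-\<^sup>1 \<circ> g\<close>, where \<open>g z = z + t z\<^sup>2 + t\<^sup>m z\<^sup>3\<close> is the symbol of the matrix and
  \<open>h z = 72/89 z + 40/89 t z\<^sup>2 + 25/178 t\<^sup>m z\<^sup>3\<close>. Once \<open>t\<close> is not
  small, \<open>k3\<close> is positive for \<open>m = 2\<close> and negative for \<open>m > 2\<close>, hence the separate boxes.
\<close>

lemma similar_to_contraction_toep4:
  fixes m :: nat and t :: real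
  assumes m: "m \<in> {2, 3, 4}" and t: "t \<in> {0..t_star m}"
  defines "k2 \<equiv> 18067/46656 * t"
    and "k3 \<equiv> 48813919/53747712 * t ^ m - 8039815/15116544 * t\<^sup>2"
  shows "similar_to_contraction 2 (toep4 (89/72) k2 k3)"
proof (cases "t \<le> 22/100")
  case True
  have "0 \<le> t" using t by simp
  have "t\<^sup>2 \<le> 484/10000"
    using power_mono[OF True \<open>0 \<le> t\<close>, of 2] by (simp add: power2_eq_square)
  moreover have "t ^ m \<le> t\<^sup>2"
    using m True \<open>0 \<le> t\<close> by (intro power_decreasing) auto
  moreover have "0 \<le> t ^ m" using \<open>0 \<le> t\<close> by simp
  \<comment> \<open>The lower bound drops \<open>t ^ m\<close>; the upper one replaces it by
    \<open>t\<^sup>2\<close>.\<close>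
  ultimately have "-258/10000 \<le> k3" "k3 \<le> 183/10000"
    unfolding k3_def by linarith+
  then show ?thesis
    using True \<open>0 \<le> t\<close> by (intro similar_to_contraction_small_t) (simp_all add: k2_def)
next
  case False
  then have t_lower: "22/100 \<le> t" by simp
  then have sq: "(22/100)\<^sup>2 \<le> t\<^sup>2" by (intro power_mono) auto
  show ?thesis
  proof (cases "m = 2")
    case True
    then have "t \<le> 363/1000" using t by (simp add: t_star_def)
    moreover from this have "t\<^sup>2 \<le> (363/1000)\<^sup>2" using t_lower by (intro power_mono) auto
    ultimately show ?thesis
      using t_lower sq True
      by (intro similar_to_contraction_quadratic) (simp_all add: k2_def k3_def power2_eq_square)
  next
    case False
    then have m34: "m = 3 \<or> m = 4" using m by auto
    then have t_upper: "t \<le> 368/1000" using t by (auto simp: t_star_def)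
    define s where "s = t\<^sup>2"
    have s_lower: "484/10000 \<le> s" using sq by (simp add: s_def power2_eq_square)
    have s_upper: "s \<le> 1355/10000"
      using power_mono[OF t_upper, of 2] t_lower by (simp add: s_def power2_eq_square)
    have power_upper: "t ^ m \<le> 368/1000 * s"
    proof -
      have "t ^ m \<le> t ^ 3" using m34 t_lower t_upper by (intro power_decreasing) auto
      also have "\<dots> = t * s" by (simp add: s_def power3_eq_cube power2_eq_square)
      also have "\<dots> \<le> 368/1000 * s" using t_upper s_lower by (intro mult_right_mono) auto
      finally show ?thesis .
    qed
    have power_lower: "s\<^sup>2 \<le> t ^ m"
    proof -
      have "s\<^sup>2 = t ^ 4" by (simp add: s_def)
      also have "\<dots> \<le> t ^ m" using m34 t_lower t_upper by (intro power_decreasing) auto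
      finally show ?thesis .
    qed
    have factor: "(c - s) * (b - a * (c + s)) = c * (b - a * c) + a * s\<^sup>2 - b * s"
      for a b c :: real
      by (simp add: power2_eq_square algebra_simps)
    \<comment> \<open>By \<open>factor\<close> this says that the quadratic
      \<open>a * s\<^sup>2 - b * s\<close> is at least its value at the right end
      \<open>c = 1355/10000\<close>.\<close>
    have "0 \<le> (1355/10000 - s) * (8039815/15116544 - 48813919/53747712 * (1355/10000 + s))"
      using s_upper by (intro mult_nonneg_nonneg) auto
    also have "\<dots> = 1355/10000 * (8039815/15116544 - 48813919/53747712 * (1355/10000))
        + 48813919/53747712 * s\<^sup>2 - 8039815/15116544 * s"
      by (rule factor)
    also have "\<dots> \<le> 555/10000 + 48813919/53747712 * s\<^sup>2 - 8039815/15116544 * s"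
      by simp
    finally have "-555/10000 \<le> k3"
      using power_lower unfolding k3_def s_def[symmetric] by linarith
    \<comment> \<open>After \<open>power_upper\<close> the coefficient of \<open>s\<close> is
      negative, so the smallest \<open>s\<close> is the worst case.\<close>
    moreover have "k3 \<le> -95/10000"
      using power_upper s_lower unfolding k3_def s_def[symmetric] by linarith
    ultimately show ?thesis
      using t_lower t_upper by (intro similar_to_contraction_higher) (simp_all add: k2_def)
  qed
qed

section \<open>From the unit circle to the numerical range\<close>

lemma curve_in_numerical_range:
  assumes "norm z = 1"
  shows "poly [:0, 72/89, 40/89 * of_real t, 25/178 * of_real t ^ m:] z \<in> numerical_range (A_mat t m)"
proof -
  \<comment> \<open>Here 178 = 25 + 64 + 64 + 25. The ratio 8/5 approximates the golden ratio in the
    top eigenvector of the Hermitian part of J, which brings 72/89 close to the numerical radius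
    cos(pi/5) of J.\<close>
  define r where "r = 1 / sqrt 178"
  have r: "r * r = 1 / 178" by (simp add: r_def)
  define x :: "complex^4" where
    "x = vector [of_real (5 * r), of_real (8 * r) * z, of_real (8 * r) * z\<^sup>2, of_real (5 * r) * z ^ 3]"
  have z: "z * cnj z = 1"
    using assms complex_norm_square[of z] by simp
  have "(norm x)\<^sup>2 = 1"
    by (simp add: x_def norm_vec_def L2_set_def sum_nonneg sum_4 norm_mult norm_power assms
        power2_eq_square r)
  then have "norm x = 1"
    by (simp add: power2_eq_1_iff) (smt (verit) norm_ge_zero)
  moreover have "cdot (A_mat t m *v x) x
      = poly [:0, 72/89, 40/89 * of_real t, 25/178 * of_real t ^ m:] z"
  proof -
    have rr: "complex_of_real r * complex_of_real r = 1 / 178"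
      using r by (metis of_real_mult of_real_divide of_real_1 of_real_numeral)
    \<comment> \<open>Products of the weights 5, 8, 8, 5 at distance 1, 2, 3 sum to 144, 80,
      25.\<close>
    have "cdot (A_mat t m *v x) x = of_real r * of_real r *
        (40 * z + 64 * z * (z * cnj z) + 40 * z * (z * cnj z)\<^sup>2
         + of_real t * (40 * z\<^sup>2 + 40 * z\<^sup>2 * (z * cnj z)) + of_real t ^ m * 25 * z ^ 3)"
      by (simp add: cdot_def sum_4 A_mat_eq_toep4 x_def algebra_simps power2_eq_square power3_eq_cube)
    then show ?thesis
      by (simp add: rr z field_simps power2_eq_square power3_eq_cube)
  qed
  ultimately show ?thesis
    unfolding numerical_range_def by (intro CollectI exI[of _ x] conjI) (simp_all only:)
qed

text \<open>The entries solve h(k(z)) = g(z) modulo z^4, where k is the symbol of the Toeplitz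
  matrix; nilpotency kills all higher terms.\<close>

lemma poly_mat_curve:
  fixes t :: real and m :: nat
  defines "k2 \<equiv> 18067/46656 * t"
    and "k3 \<equiv> 48813919/53747712 * t ^ m - 8039815/15116544 * t\<^sup>2"
  shows "poly_mat [:0, 72/89, 40/89 * of_real t, 25/178 * of_real t ^ m:]
    (of_real_mat (toep4 (89/72) k2 k3)) = A_mat t m"
proof -
  have "poly_mat [:0, 72/89, 40/89 * of_real t, 25/178 * of_real t ^ m:]
    (of_real_mat (toep4 (89/72) k2 k3)) *v x = A_mat t m *v x" for x
    by (simp add: vec_eq_iff forall_4 of_real_mat_toep4 A_mat_eq_toep4 k2_def k3_def
        power2_eq_square field_simps)
  then show ?thesis by (simp add: matrix_eq)
qed

theorem corollary3p8:
  fixes m :: nat and t :: real and p :: "complex poly"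
  assumes "m \<in> {2, 3, 4}" and "t \<in> {0..t_star m}"
  shows "op_norm (poly_mat p (A_mat t m))
    \<le> 2 * (SUP z\<in>numerical_range (A_mat t m). norm (poly p z))"
proof -
  define M where "M = (SUP z\<in>numerical_range (A_mat t m). norm (poly p z))"
  define h :: "complex poly" where "h = [:0, 72/89, 40/89 * of_real t, 25/178 * of_real t ^ m:]"
  define T where "T = toep4 (89/72) (18067/46656 * t)
    (48813919/53747712 * t ^ m - 8039815/15116544 * t\<^sup>2)"
  have T: "similar_to_contraction 2 T"
    unfolding T_def by (rule similar_to_contraction_toep4[OF assms])
  have bound: "norm (poly (pcompose p h) z) \<le> M" if "norm z = 1" for z
  proof -
    obtain z0 where "\<And>w. w \<in> numerical_range (A_mat t m) \<Longrightarrow> norm (poly p w) \<le> norm (poly p z0)"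
      "M = norm (poly p z0)"
      using SUP_numerical_range_attained[of "A_mat t m" p] unfolding M_def by metis
    then show ?thesis
      using curve_in_numerical_range[OF that] by (simp add: poly_pcompose h_def)
  qed
  have nilpotent: "mat_power (of_real_mat T) 4 = 0"
    by (simp add: T_def of_real_mat_toep4 toep4_nilpotent)
  \<comment> \<open>As \<open>A_mat t m\<close> is h(T), p(A) is \<open>pcompose p h\<close> at
    \<open>T\<close>; the constant 2 is the bound \<open>K\<close> of the similarity.\<close>
  have "norm (poly_mat p (A_mat t m) *v x) \<le> 2 * M * norm x" for x
    using norm_poly_mat_le[OF T nilpotent bound, of x]
    by (simp only: poly_mat_pcompose poly_mat_curve h_def T_def)
  then show ?thesis
    unfolding op_norm_def M_def by (rule onorm_le)
qed

end
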